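(* Let $r:[L_1,L_2]\to\mathbb{R}^3$ be a curve parametrized by arc length with $r''(s)\neq0$ for all $s$. Then there exists a ruled surface $P(s,t)$ possessing $r$ as a common (isoparametric) geodesic curve; that is, there exist $t_0\in\mathbb{R}$ and a vector field $d:[L_1,L_2]\to\mathbb{R}^3$ along $r$ such that $r$ is a geodesic on the ruled surface $P(s,t)=r(s)+(t-t_0)\,d(s)$.
   Context: Curves are sufficiently smooth for all derivatives used to exist, and the vector field $d$ is required to be differentiable. For an arc-length curve $r$ with $r''\neq0$, $T=r'$ and the principal normal is $N=r''/\|r''\|$. For a parametric surface $P(s,t)$ with $P(s,t_0)=r(s)$ for all $s$ (so that $r$ is isoparametric), the surface normal is $n(s,t)=\frac{\partial P}{\partial s}\times\frac{\partial P}{\partial t}$, and $r$ is a geodesic on $P$ if, for all $s$, $n(s,t_0)$ is parallel to $N(s)$, i.e. is a nonzero multiple of $N(s)$. *)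

theory Defs
  imports "HOL-Analysis.Analysis"
begin

text \<open>Derivatives along a curve are one-sided at the endpoints of the parameter interval.\<close>

definition curve_deriv ::
  "real \<Rightarrow> real \<Rightarrow> (real \<Rightarrow> 'a::real_normed_vector) \<Rightarrow> real \<Rightarrow> 'a" where
  "curve_deriv a b f s = vector_derivative f (at s within {a..b})"

definition times_differentiable_curve ::
  "nat \<Rightarrow> real \<Rightarrow> real \<Rightarrow> (real \<Rightarrow> 'a::real_normed_vector) \<Rightarrow> bool" where
  "times_differentiable_curve n a b f \<longleftrightarrow>
     (\<forall>k<n. ((curve_deriv a b ^^ k) f) differentiable_on {a..b})"

definition arc_length_curve ::
  "real \<Rightarrow> real \<Rightarrow> (real \<Rightarrow> 'a::real_normed_vector) \<Rightarrow> bool" where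
  "arc_length_curve a b r \<longleftrightarrow>
     r differentiable_on {a..b} \<and> (\<forall>s\<in>{a..b}. norm (curve_deriv a b r s) = 1)"

definition principal_normal ::
  "real \<Rightarrow> real \<Rightarrow> (real \<Rightarrow> real ^ 3) \<Rightarrow> real \<Rightarrow> real ^ 3" where
  "principal_normal a b r s =
     curve_deriv a b (curve_deriv a b r) s /\<^sub>R norm (curve_deriv a b (curve_deriv a b r) s)"

text \<open>
  A parametric surface is a map \<open>P s t\<close> with \<open>s \<in> {a..b}\<close> and \<open>t\<close> ranging over all reals.
\<close>

definition surface_normal ::
  "real \<Rightarrow> real \<Rightarrow> (real \<Rightarrow> real \<Rightarrow> real ^ 3) \<Rightarrow> real \<Rightarrow> real \<Rightarrow> real ^ 3" where
  "surface_normal a b P s t =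
     cross3 (vector_derivative (\<lambda>u. P u t) (at s within {a..b}))
            (vector_derivative (\<lambda>v. P s v) (at t))"

definition isoparametric_curve ::
  "real \<Rightarrow> real \<Rightarrow> (real \<Rightarrow> real \<Rightarrow> real ^ 3) \<Rightarrow> real \<Rightarrow> (real \<Rightarrow> real ^ 3) \<Rightarrow> bool" where
  "isoparametric_curve a b P t0 r \<longleftrightarrow> (\<forall>s\<in>{a..b}. P s t0 = r s)"

text \<open>
  The differentiability conjunct makes the partial derivatives in
  \<^const>\<open>surface_normal\<close> genuine: \<^const>\<open>vector_derivative\<close> is an unspecified
  value where no derivative exists.
\<close>

definition isoparametric_geodesic ::
  "real \<Rightarrow> real \<Rightarrow> (real \<Rightarrow> real \<Rightarrow> real ^ 3) \<Rightarrow> real \<Rightarrow> (real \<Rightarrow> real ^ 3) \<Rightarrow> bool" where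
  "isoparametric_geodesic a b P t0 r \<longleftrightarrow>
     (\<lambda>(s, t). P s t) differentiable_on ({a..b} \<times> UNIV) \<and>
     isoparametric_curve a b P t0 r \<and>
     (\<forall>s\<in>{a..b}. \<exists>c. c \<noteq> 0 \<and> surface_normal a b P s t0 = c *\<^sub>R principal_normal a b r s)"

definition ruled_surface ::
  "(real \<Rightarrow> real ^ 3) \<Rightarrow> (real \<Rightarrow> real ^ 3) \<Rightarrow> real \<Rightarrow> real \<Rightarrow> real \<Rightarrow> real ^ 3" where
  "ruled_surface r d t0 s t = r s + (t - t0) *\<^sub>R d s"

end

theory Submission
  imports Defs
begin

text \<open>
  The rulings point along the binormal, scaled by the curvature: \<open>d = T \<times> T'\<close>, where \<open>T = r'\<close>.
  Along \<open>r\<close> the two partial derivatives of the surface are \<open>T\<close> and \<open>d\<close>, so the surface normal is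
  \<open>T \<times> (T \<times> T')\<close>. Since \<open>T\<close> is a unit field, \<open>T'\<close> is orthogonal to \<open>T\<close>
  (\<open>unit_field_orthogonal_curve_deriv\<close>), and Lagrange's formula collapses the triple product
  (\<open>cross3_cross3_orthogonal_unit\<close>) to \<open>-T'\<close>, which is \<open>-\<parallel>r''\<parallel>\<close> times the principal normal and
  nonzero because \<open>r''\<close> does not vanish. Keeping the curvature factor, instead of normalising to
  the unit binormal, makes \<open>d\<close> differentiable by the product rule alone;
  this is where the third derivative of \<open>r\<close> enters.
\<close>

lemma ruled_surface_differentiable_on:
  assumes "r differentiable_on S" "d differentiable_on S"
  shows "(\<lambda>(s, t). ruled_surface r d t0 s t) differentiable_on (S \<times> UNIV)"
proof -
  have fst_comp: "(\<lambda>p :: real \<times> real. f (fst p)) differentiable_on (S \<times> UNIV)"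
    if "f differentiable_on S" for f :: "real \<Rightarrow> real ^ 3"
  proof (rule differentiable_on_compose[of fst])
    show "(fst :: real \<times> real \<Rightarrow> real) differentiable_on S \<times> UNIV"
      by (intro bounded_linear_imp_differentiable_on bounded_linear_fst)
    show "f differentiable_on fst ` (S \<times> (UNIV :: real set))"
      using that by simp
  qed
  have "(\<lambda>p :: real \<times> real. snd p - t0) differentiable_on (S \<times> UNIV)"
    by (intro differentiable_on_diff differentiable_on_const
        bounded_linear_imp_differentiable_on bounded_linear_snd)
  then have "(\<lambda>p. r (fst p) + (snd p - t0) *\<^sub>R d (fst p)) differentiable_on (S \<times> UNIV)"
    using assms by (intro differentiable_on_add differentiable_on_scaleR fst_comp)
  then show ?thesis
    by (simp add: ruled_surface_def case_prod_unfold)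
qed

unbundle cross3_syntax

lemma curve_deriv_has_vector_derivative:
  assumes "f differentiable_on {a..b}" "s \<in> {a..b}"
  shows "(f has_vector_derivative curve_deriv a b f s) (at s within {a..b})"
  using assms by (simp add: curve_deriv_def differentiable_on_def vector_derivative_works)

text \<open>
  Differentiating the constant \<open>T \<bullet> T = 1\<close> gives \<open>2 (T \<bullet> T') = 0\<close>. Nondegeneracy of the interval
  makes derivatives unique, also the one-sided ones at the endpoints.
\<close>

lemma unit_field_orthogonal_curve_deriv:
  fixes T :: "real \<Rightarrow> 'a::real_inner"
  assumes "a < b" "T differentiable_on {a..b}"
    and unit: "\<And>u. u \<in> {a..b} \<Longrightarrow> norm (T u) = 1"
    and s: "s \<in> {a..b}"
  shows "T s \<bullet> curve_deriv a b T s = 0"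
proof -
  have T': "(T has_vector_derivative curve_deriv a b T s) (at s within {a..b})"
    using assms by (simp add: curve_deriv_has_vector_derivative)
  have "((\<lambda>u. T u \<bullet> T u) has_vector_derivative
          T s \<bullet> curve_deriv a b T s + curve_deriv a b T s \<bullet> T s) (at s within {a..b})"
    by (rule bounded_bilinear.has_vector_derivative[OF bounded_bilinear_inner T' T'])
  moreover have "((\<lambda>u. T u \<bullet> T u) has_vector_derivative 0) (at s within {a..b})"
  proof (rule has_vector_derivative_transform[OF s])
    show "((\<lambda>u. 1) has_vector_derivative 0) (at s within {a..b})"
      by (rule has_vector_derivative_const)
    show "\<And>u. u \<in> {a..b} \<Longrightarrow> T u \<bullet> T u = 1"
      using unit by (simp add: dot_square_norm)
  qed
  ultimately have "T s \<bullet> curve_deriv a b T s + curve_deriv a b T s \<bullet> T s = 0"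
    using \<open>a < b\<close> s vector_derivative_unique_within_closed_interval[of a b s] by auto
  then show ?thesis
    by (simp add: inner_commute)
qed

text \<open>
  By Lagrange's formula \<open>u \<times> (u \<times> v) = (u \<bullet> v) u - (u \<bullet> u) v\<close>; on the plane orthogonal to \<open>u\<close>
  the operator \<open>u \<times> _\<close> is a quarter turn.
\<close>

lemma cross3_cross3_orthogonal_unit:
  assumes "norm u = 1" "u \<bullet> v = 0"
  shows "u \<times> (u \<times> v) = - v"
  using assms by (simp add: Lagrange dot_square_norm)

lemma cross3_differentiable_on:
  fixes f g :: "'a::real_normed_vector \<Rightarrow> real ^ 3"
  assumes "f differentiable_on S" "g differentiable_on S"
  shows "(\<lambda>x. f x \<times> g x) differentiable_on S"
proof -
  interpret bounded_bilinear cross3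
    using bilinear_cross bilinear_conv_bounded_bilinear by blast
  show ?thesis
    using assms unfolding differentiable_on_def differentiable_def by (blast intro: FDERIV)
qed

text \<open>
  At \<open>t = t0\<close> the term \<open>(t - t0) d(s)\<close> vanishes identically in \<open>s\<close>, so \<open>d'\<close> does not enter the
  normal along the base curve.
\<close>

lemma surface_normal_ruled_surface:
  "surface_normal a b (ruled_surface r d t0) s t0 = curve_deriv a b r s \<times> d s"
proof -
  have "((\<lambda>v. ruled_surface r d t0 s v) has_vector_derivative d s) (at t0)"
    unfolding ruled_surface_def by (auto intro!: derivative_eq_intros)
  then have "vector_derivative (\<lambda>v. ruled_surface r d t0 s v) (at t0) = d s"
    by (rule vector_derivative_at)
  then show ?thesis
    by (simp add: surface_normal_def curve_deriv_def ruled_surface_def)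
qed

theorem theorem4p1:
  fixes L1 L2 :: real and r :: "real \<Rightarrow> real ^ 3"
  assumes "L1 < L2"
    and "times_differentiable_curve 3 L1 L2 r"
    and "arc_length_curve L1 L2 r"
    and "\<And>s. s \<in> {L1..L2} \<Longrightarrow> curve_deriv L1 L2 (curve_deriv L1 L2 r) s \<noteq> 0"
  shows "\<exists>(t0 :: real) (d :: real \<Rightarrow> real ^ 3).
           d differentiable_on {L1..L2} \<and>
           isoparametric_geodesic L1 L2 (ruled_surface r d t0) t0 r"
proof -
  define T where "T = curve_deriv L1 L2 r"
  define T' where "T' = curve_deriv L1 L2 T"
  define d where "d = (\<lambda>s. T s \<times> T' s)"
  have differentiable: "((curve_deriv L1 L2 ^^ k) r) differentiable_on {L1..L2}" if "k < 3" for k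
    using assms(2) that by (simp add: times_differentiable_curve_def)
  have r: "r differentiable_on {L1..L2}"
    using differentiable[of 0] by simp
  have T: "T differentiable_on {L1..L2}"
    using differentiable[of 1] by (simp add: T_def)
  have T': "T' differentiable_on {L1..L2}"
    using differentiable[of 2] by (simp add: T'_def T_def numeral_2_eq_2)
  have unit: "norm (T s) = 1" if "s \<in> {L1..L2}" for s
    using assms(3) that by (simp add: arc_length_curve_def T_def)
  have d: "d differentiable_on {L1..L2}"
    unfolding d_def by (rule cross3_differentiable_on[OF T T'])
  have normal: "\<exists>c. c \<noteq> 0 \<and>
      surface_normal L1 L2 (ruled_surface r d 0) s 0 = c *\<^sub>R principal_normal L1 L2 r s"
    if s: "s \<in> {L1..L2}" for s
  proof -
    have T'_nonzero: "T' s \<noteq> 0"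
      using assms(4)[OF s] by (simp add: T'_def T_def)
    have "T s \<bullet> T' s = 0"
      unfolding T'_def using \<open>L1 < L2\<close> T unit s by (rule unit_field_orthogonal_curve_deriv)
    then have "surface_normal L1 L2 (ruled_surface r d 0) s 0 = - T' s"
      using unit[OF s]
      by (simp add: surface_normal_ruled_surface d_def cross3_cross3_orthogonal_unit flip: T_def)
    also have "\<dots> = (- norm (T' s)) *\<^sub>R principal_normal L1 L2 r s"
      using T'_nonzero by (simp add: principal_normal_def flip: T_def T'_def)
    finally show ?thesis
      using T'_nonzero by (intro exI[of _ "- norm (T' s)"]) simp
  qed
  have "isoparametric_curve L1 L2 (ruled_surface r d 0) 0 r"
    by (simp add: isoparametric_curve_def ruled_surface_def)
  then have "isoparametric_geodesic L1 L2 (ruled_surface r d 0) 0 r"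
    using ruled_surface_differentiable_on[OF r d] normal
    by (simp add: isoparametric_geodesic_def)
  with d show ?thesis
    by blast
qed

end
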